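(* Consider anonymous agents in the asynchronous model with FW whiteboards, with half-duplex or full-duplex links. In each of these models, for every $k\ge 1$, the quiescence number of the $k$-gossip problem is $0$; that is, a $0$-quiescent self-stabilizing solution exists and no $l$-quiescent self-stabilizing solution exists for any $l \ge 1$.
   Context: Network: a finite connected graph $G=(V,E)$. Nodes are anonymous (nodes of the same degree are identical). Each node labels its incident links with locally distinct labels; nothing else is assumed about the labels. Each node has a whiteboard (a public memory). Agents: $k$ mobile agents, each a deterministic state machine (with no a priori bound on its number of states), are present at all times. In the anonymous agent model agents have no identifiers and are all identical. When an agent at a node executes its action, it may change its state, write on the node's whiteboard, and move to a neighboring node (or stay), based only on: its own state, the states of the agents currently at the same node, the local link labels of the node (and possibly the label of the incoming link), and the contents of the node's whiteboard. The algorithm is the same for all agents; it is given neither $k$ nor the network. Asynchronous model: there is no bound on the number of moves an agent can make between two moves of another agent, but each agent is always eventually allowed to execute its action; agents at the same node act sequentially, agents at different nodes may act concurrently. Links. Full-duplex: two agents at neighboring nodes can swap positions simultaneously over the link joining them without meeting. Half-duplex: only one direction can be used at a time; if two agents at opposite ends try to cross simultaneously, only one succeeds. FW whiteboards: any information can be stored on whiteboards, including gossip information. $k$-gossip problem: each of the $k$ agents is given an initial piece of information (gossip information), treated as opaque. Gossip information is transferred from agent to agent by meeting at a node or by being written on and read from a whiteboard; agents may relay all gossip information collected. The goal is that every agent obtains the gossip information of all agents. Self-stabilizing solution: one algorithm, not depending on $k$ or on the network, such that for every network, every number of agents, and every initial configuration (arbitrary agent locations and states, arbitrary whiteboard contents),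 in every execution every agent eventually knows the gossip information of all agents in the system. $l$-quiescent (for an integer $l$, when $k$ agents are present): every execution with $k$ agents reaches a configuration after which $l$ or more agents remain still (never move) forever. The quiescence number of the $k$-gossip problem in a model is the maximum integer $l$ such that an $l$-quiescent self-stabilizing solution exists, and it is $-1$ if no $0$-quiescent self-stabilizing solution exists. *)

theory Defs
  imports "Graph_Theory.Graph_Theory" "HOL-Library.Multiset"
begin

text \<open>
  Nodes and link labels are natural numbers. The label \<^term>\<open>label N u v\<close> is the one that
  node \<^term>\<open>u\<close> gives to its link to \<^term>\<open>v\<close>. A finite simple undirected
  graph is a finite symmetric loop-free digraph without parallel arcs.
\<close>

record network =
  topology :: "nat pair_pre_digraph"
  label :: "nat \<Rightarrow> nat \<Rightarrow> nat"

definition nbrs :: "network \<Rightarrow> nat \<Rightarrow> nat set" where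
  "nbrs N u = {v. (u, v) \<in> parcs (topology N)}"

definition network :: "network \<Rightarrow> bool" where
  "network N \<longleftrightarrow>
     pair_graph (topology N) \<and> connected (with_proj (topology N)) \<and>
     (\<forall>u\<in>pverts (topology N). inj_on (label N u) (nbrs N u))"

definition labels_at :: "network \<Rightarrow> nat \<Rightarrow> nat set" where
  "labels_at N u = label N u ` nbrs N u"

text \<open>
  An algorithm is one deterministic transition function, shared by all agents, over control
  states \<open>'q\<close> and control contents \<open>'w\<close> of whiteboards. It sees neither
  agent names nor node names, nor the number of agents, nor the network.

  Gossip information is kept apart from the control data, so that the algorithm can copy it but
  cannot inspect or compare it (otherwise it could serve as an identifier). The two sets of sources
  in an action say which gossip information is added to the memory of the agent, and which is
  put on the whiteboard in place of its previous gossip information.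
\<close>

datatype gossip_source =
    Memory  \<comment> \<open>what the acting agent knows\<close>
  | Board   \<comment> \<open>what is written on the whiteboard of its node\<close>
  | Met     \<comment> \<open>what the other agents at its node know\<close>

record ('q, 'w) view =
  own_state :: 'q
  other_states :: "'q multiset"
  link_labels :: "nat set"
  entry_label :: "nat option"
  board :: 'w

record ('q, 'w) action =
  new_state :: 'q
  new_board :: 'w
  exit_label :: "nat option"  \<comment> \<open>\<^const>\<open>None\<close>: stay at the node\<close>
  learn_from :: "gossip_source set"
  post_from :: "gossip_source set"

type_synonym ('q, 'w) algorithm = "('q, 'w) view \<Rightarrow> ('q, 'w) action"

text \<open>
  The agents are \<open>0, \<dots>, k - 1\<close>; these names exist only in the semantics. The
  initial gossip information of agent \<open>a\<close> is \<open>g a\<close>: it is an input, not part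
  of the configuration, hence never corrupted. The entry label of an agent is the label, at its
  present node, of the link through which it last arrived (if any).
\<close>

record ('q, 'w) config =
  loc :: "nat \<Rightarrow> nat"
  state :: "nat \<Rightarrow> 'q"
  entry :: "nat \<Rightarrow> nat option"
  memory :: "nat \<Rightarrow> nat set"
  content :: "nat \<Rightarrow> 'w"
  posted :: "nat \<Rightarrow> nat set"

definition config_ok :: "network \<Rightarrow> nat \<Rightarrow> ('q, 'w) config \<Rightarrow> bool" where
  "config_ok N k c \<longleftrightarrow>
     (\<forall>a<k. loc c a \<in> pverts (topology N) \<and>
            (\<forall>p. entry c a = Some p \<longrightarrow> p \<in> labels_at N (loc c a)))"

definition knows :: "(nat \<Rightarrow> nat) \<Rightarrow> ('q, 'w) config \<Rightarrow> nat \<Rightarrow> nat set" where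
  "knows g c a = insert (g a) (memory c a)"

definition others_here :: "nat \<Rightarrow> ('q, 'w) config \<Rightarrow> nat \<Rightarrow> nat set" where
  "others_here k c a = {b. b < k \<and> b \<noteq> a \<and> loc c b = loc c a}"

definition view_of :: "network \<Rightarrow> nat \<Rightarrow> ('q, 'w) config \<Rightarrow> nat \<Rightarrow> ('q, 'w) view" where
  "view_of N k c a =
     \<lparr> own_state = state c a,
       other_states = image_mset (state c) (mset_set (others_here k c a)),
       link_labels = labels_at N (loc c a),
       entry_label = entry c a,
       board = content c (loc c a) \<rparr>"

text \<open>An exit label that is not the label of any incident link leaves the agent where it is.\<close>

definition target :: "network \<Rightarrow> nat \<Rightarrow> nat option \<Rightarrow> nat" where
  "target N u e =
     (case e of
        None \<Rightarrow> u
      | Some p \<Rightarrow> if p \<in> labels_at N u then (THE v. v \<in> nbrs N u \<and> label N u v = p) else u)"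

definition destination ::
  "('q, 'w) algorithm \<Rightarrow> network \<Rightarrow> nat \<Rightarrow> ('q, 'w) config \<Rightarrow> nat \<Rightarrow> nat" where
  "destination A N k c a = target N (loc c a) (exit_label (A (view_of N k c a)))"

fun gossip_of ::
  "nat \<Rightarrow> (nat \<Rightarrow> nat) \<Rightarrow> ('q, 'w) config \<Rightarrow> nat \<Rightarrow> gossip_source \<Rightarrow> nat set" where
  "gossip_of k g c a Memory = knows g c a"
| "gossip_of k g c a Board = posted c (loc c a)"
| "gossip_of k g c a Met = (\<Union>b\<in>others_here k c a. knows g c b)"

datatype link_mode = Full_Duplex | Half_Duplex

text \<open>
  One step: the agents in \<open>S\<close> execute their actions concurrently. Agents at the same
  node act sequentially, so \<open>S\<close> has at most one agent per node. Over a half-duplex link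
  at most one of two opposite crossings can succeed in a step; an agent that loses
  has not executed its action and therefore does not belong to \<open>S\<close>.
\<close>

definition step ::
  "link_mode \<Rightarrow> ('q, 'w) algorithm \<Rightarrow> network \<Rightarrow> nat \<Rightarrow> (nat \<Rightarrow> nat) \<Rightarrow> nat set \<Rightarrow>
   ('q, 'w) config \<Rightarrow> ('q, 'w) config \<Rightarrow> bool" where
  "step d A N k g S c c' \<longleftrightarrow>
     S \<subseteq> {..<k} \<and> inj_on (loc c) S \<and>
     (d = Half_Duplex \<longrightarrow>
        \<not> (\<exists>a\<in>S. \<exists>b\<in>S. a \<noteq> b \<and>
             destination A N k c a = loc c b \<and> destination A N k c b = loc c a)) \<and>
     (\<forall>a\<in>S.
        let act = A (view_of N k c a); u = loc c a; v = destination A N k c a in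
          loc c' a = v \<and>
          state c' a = new_state act \<and>
          entry c' a = (if v = u then entry c a else Some (label N v u)) \<and>
          memory c' a = memory c a \<union> (\<Union>s\<in>learn_from act. gossip_of k g c a s) \<and>
          content c' u = new_board act \<and>
          posted c' u = (\<Union>s\<in>post_from act. gossip_of k g c a s)) \<and>
     (\<forall>a. a \<notin> S \<longrightarrow>
        loc c' a = loc c a \<and> state c' a = state c a \<and>
        entry c' a = entry c a \<and> memory c' a = memory c a) \<and>
     (\<forall>u. u \<notin> loc c ` S \<longrightarrow> content c' u = content c u \<and> posted c' u = posted c u)"

text \<open>
  Apart from the locations and entry labels having to exist in the network, the initial
  configuration is unrestricted. The schedule is arbitrary except that every agent executes
  its action infinitely often.
\<close>

definition execution ::
  "link_mode \<Rightarrow> ('q, 'w) algorithm \<Rightarrow> network \<Rightarrow> nat \<Rightarrow> (nat \<Rightarrow> nat) \<Rightarrow>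
   (nat \<Rightarrow> ('q, 'w) config) \<Rightarrow> bool" where
  "execution d A N k g c \<longleftrightarrow>
     config_ok N k (c 0) \<and>
     (\<exists>S. (\<forall>n. step d A N k g (S n) (c n) (c (Suc n))) \<and>
          (\<forall>a<k. \<forall>n. \<exists>m\<ge>n. a \<in> S m))"

definition self_stabilizing_gossip :: "link_mode \<Rightarrow> ('q, 'w) algorithm \<Rightarrow> bool" where
  "self_stabilizing_gossip d A \<longleftrightarrow>
     (\<forall>N k g c. network N \<and> k \<ge> 1 \<and> execution d A N k g c \<longrightarrow>
        (\<forall>a<k. \<exists>n. g ` {..<k} \<subseteq> knows g (c n) a))"

definition quiescent :: "link_mode \<Rightarrow> int \<Rightarrow> nat \<Rightarrow> ('q, 'w) algorithm \<Rightarrow> bool" where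
  "quiescent d l k A \<longleftrightarrow>
     (\<forall>N g c. network N \<and> execution d A N k g c \<longrightarrow>
        (\<exists>n Q. Q \<subseteq> {..<k} \<and> l \<le> int (card Q) \<and>
               (\<forall>a\<in>Q. \<forall>m\<ge>n. loc (c m) a = loc (c n) a)))"

text \<open>
  States and whiteboard contents are unbounded but countable, hence encoded as natural numbers.
\<close>

definition quiescent_solution_exists :: "link_mode \<Rightarrow> nat \<Rightarrow> int \<Rightarrow> bool" where
  "quiescent_solution_exists d k l \<longleftrightarrow>
     (\<exists>A :: (nat, nat) algorithm. self_stabilizing_gossip d A \<and> quiescent d l k A)"

definition quiescence_number :: "link_mode \<Rightarrow> nat \<Rightarrow> int" where
  "quiescence_number d k =
     (if quiescent_solution_exists d k 0
      then GREATEST l. quiescent_solution_exists d k l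
      else -1)"

end

theory Submission
  imports Defs "HOL-Library.Nat_Bijection"
begin

text \<open>
  An agent can explore every network without reading whiteboards: its state is a counter into a
  fixed sequence of link labels in which every finite word occurs arbitrarily late, and every
  network has a word that leads past a given node from any start. So all agents visit a common
  node infinitely often, leave what they know there, and later collect it.

  Conversely, let \<open>k\<close> agents run in lockstep on a ring of \<open>3 k\<close> nodes with
  consistently oriented labels. By symmetry, if one of them stops, all do. Their common
  state is then also a stopped configuration of two agents on a ring of \<open>6\<close> nodes. Taken as
  initial configuration with empty memories, it keeps the two agents apart forever, so the
  algorithm does not solve gossip for two agents.
\<close>

section \<open>A universal traversal\<close>

text \<open>
  Cantor's enumeration of pairs runs through the diagonals \<open>x + y = n\<close>; the
  \<open>n\<close>-th diagonal spells out the word encoded by the first component of \<open>n\<close>.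
\<close>

definition universal_seq :: "nat \<Rightarrow> nat" where
  "universal_seq n =
     (let (x, y) = prod_decode n; ps = list_decode (fst (prod_decode (x + y)))
      in if x < length ps then ps ! x else 0)"

text \<open>Diagonal \<open>k\<close> starts at position \<open>triangle k\<close> and has
  \<open>k + 1\<close> entries. The component \<open>y\<close> of \<open>k\<close> is free; it is
  chosen so large that the diagonal starts at \<open>i\<close> or later and holds all of
  \<open>ps\<close>.\<close>

lemma universal_seq_contains:
  "\<exists>j\<ge>i. \<forall>x<length ps. universal_seq (j + x) = ps ! x"
proof -
  define y where "y = max i (length ps)"
  define k where "k = prod_encode (list_encode ps, y)"
  have ky: "y \<le> k" unfolding k_def by (rule le_prod_encode_2)
  have "k \<le> prod_encode (0, k)" by (rule le_prod_encode_2)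
  then have "k \<le> triangle k" by (simp add: prod_encode_def)
  then have "i \<le> triangle k" using ky by (simp add: y_def)
  moreover have "universal_seq (triangle k + x) = ps ! x" if "x < length ps" for x
  proof -
    have xk: "x \<le> k" using that ky by (simp add: y_def)
    then have "triangle k + x = prod_encode (x, k - x)" by (simp add: prod_encode_def)
    then have "prod_decode (triangle k + x) = (x, k - x)" by simp
    then show ?thesis using xk that by (simp add: universal_seq_def k_def)
  qed
  ultimately show ?thesis by blast
qed

section \<open>Walks spelled by words of labels\<close>

definition follow :: "network \<Rightarrow> nat \<Rightarrow> nat list \<Rightarrow> nat" where
  "follow N = foldl (\<lambda>u p. target N u (Some p))"

lemma target_label:
  assumes "network N" "(u, v) \<in> parcs (topology N)"
  shows "target N u (Some (label N u v)) = v"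
proof -
  interpret pair_graph "topology N" using assms(1) by (simp add: network_def)
  have v: "v \<in> nbrs N u" using assms(2) by (simp add: nbrs_def)
  have "u \<in> pverts (topology N)" using arc_fst_in_verts[OF assms(2)] by simp
  then have "inj_on (label N u) (nbrs N u)" using assms(1) by (simp add: network_def)
  then have "(THE w. w \<in> nbrs N u \<and> label N u w = label N u v) = v"
    using v by (intro the_equality) (auto dest: inj_onD)
  then show ?thesis using v by (simp add: target_def labels_at_def)
qed

lemma target_in_verts:
  assumes "network N" "u \<in> pverts (topology N)"
  shows "target N u e \<in> pverts (topology N)"
proof -
  interpret pair_graph "topology N" using assms(1) by (simp add: network_def)
  show ?thesis
  proof (cases "\<exists>v. (u, v) \<in> parcs (topology N) \<and> e = Some (label N u v)")
    case True
    then obtain v where v: "(u, v) \<in> parcs (topology N)" "e = Some (label N u v)" by blast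
    then show ?thesis using target_label[OF assms(1) v(1)] arc_snd_in_verts[OF v(1)] by simp
  next
    case False
    then have "target N u e = u"
      by (auto simp: target_def labels_at_def nbrs_def split: option.splits)
    then show ?thesis using assms(2) by simp
  qed
qed

lemma follow_in_verts:
  assumes "network N" "u \<in> pverts (topology N)"
  shows "follow N u ps \<in> pverts (topology N)"
  using assms(2)
  by (induction ps arbitrary: u) (auto simp: follow_def target_in_verts[OF assms(1)])

lemma follow_reaches:
  assumes "network N" "u \<in> pverts (topology N)" "v \<in> pverts (topology N)"
  shows "\<exists>ps. follow N u ps = v"
proof -
  interpret pair_graph "topology N" using assms(1) by (simp add: network_def)
  have "strongly_connected (with_proj (topology N))"
    using assms(1) symmetric_connected_imp_strongly_connected[OF sym_arcs]
    by (simp add: network_def)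
  then have "(u, v) \<in> rtrancl_on (pverts (topology N)) (parcs (topology N))"
    using assms(2,3) by (auto simp: strongly_connected_def reachable_def)
  then show ?thesis
  proof (induction rule: rtrancl_on_induct)
    case base
    have "follow N u [] = u" by (simp add: follow_def)
    then show ?case by blast
  next
    case (step y z)
    then obtain ps where "follow N u ps = y" by blast
    then have "follow N u (ps @ [label N y z]) = z"
      using target_label[OF assms(1) step(2)] by (simp add: follow_def)
    then show ?case by blast
  qed
qed

text \<open>Starts are handled one at a time: the word built so far is prolonged by a piece leading
  to \<open>v\<close> from wherever it takes the new start. Earlier starts keep their
  prefixes.\<close>

lemma covering_word:
  assumes "network N" "v \<in> pverts (topology N)"
  shows "\<exists>ps. \<forall>u\<in>pverts (topology N). \<exists>i\<le>length ps. follow N u (take i ps) = v"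
proof -
  let ?V = "pverts (topology N)"
  interpret pair_graph "topology N" using assms(1) by (simp add: network_def)
  have "\<exists>ps. \<forall>u\<in>F. \<exists>i\<le>length ps. follow N u (take i ps) = v" if "finite F" "F \<subseteq> ?V" for F
    using that
  proof (induction rule: finite_induct)
    case (insert u F)
    then obtain ps where ps: "\<forall>u\<in>F. \<exists>i\<le>length ps. follow N u (take i ps) = v" by auto
    obtain qs where qs: "follow N (follow N u ps) qs = v"
      using follow_reaches[OF assms(1) follow_in_verts[OF assms(1)] assms(2)] insert.prems
      by blast
    have "\<exists>i\<le>length (ps @ qs). follow N w (take i (ps @ qs)) = v" if "w \<in> insert u F" for w
    proof (cases "w = u")
      case True
      then show ?thesis using qs by (intro exI[of _ "length (ps @ qs)"]) (simp add: follow_def)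
    next
      case False
      then obtain i where "i \<le> length ps" "follow N w (take i ps) = v" using ps \<open>w \<in> _\<close> by blast
      then show ?thesis by (intro exI[of _ i]) simp
    qed
    then show ?case by blast
  qed auto
  then show ?thesis using pair_finite_verts by blast
qed

section \<open>The traversal algorithm and its executions\<close>

text \<open>Posting replaces the gossip on a board, so \<open>Board\<close> is posted again to keep
  it. The exit label depends on the counter alone, so neither corrupted boards nor other agents can
  divert the walk.\<close>

definition traversal_gossip :: "(nat, nat) algorithm" where
  "traversal_gossip v =
     \<lparr> new_state = Suc (own_state v),
       new_board = board v,
       exit_label = Some (universal_seq (own_state v)),
       learn_from = {Board},
       post_from = {Memory, Board} \<rparr>"

locale traversal_run =
  fixes d N k g S c
  assumes net: "network N"
    and init: "config_ok N k (c 0)"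
    and steps: "\<And>n. step d traversal_gossip N k g (S n) (c n) (c (Suc n))"
    and fair: "\<And>a n. a < k \<Longrightarrow> \<exists>m\<ge>n. a \<in> S m"
begin

lemma idle:
  assumes "a \<notin> S n"
  shows "loc (c (Suc n)) a = loc (c n) a" "state (c (Suc n)) a = state (c n) a"
  using steps[of n] assms by (auto simp: step_def)

lemma acts:
  assumes "a \<in> S n"
  shows "loc (c (Suc n)) a = target N (loc (c n) a) (Some (universal_seq (state (c n) a)))"
    and "state (c (Suc n)) a = Suc (state (c n) a)"
    and "memory (c (Suc n)) a = memory (c n) a \<union> posted (c n) (loc (c n) a)"
    and "posted (c (Suc n)) (loc (c n) a) = knows g (c n) a \<union> posted (c n) (loc (c n) a)"
  using steps[of n] assms
  by (auto simp: step_def Let_def traversal_gossip_def destination_def view_of_def)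

lemma posted_mono: "m \<le> n \<Longrightarrow> posted (c m) u \<subseteq> posted (c n) u"
proof (induction rule: dec_induct)
  case (step n)
  have "posted (c n) u \<subseteq> posted (c (Suc n)) u"
  proof (cases "u \<in> loc (c n) ` S n")
    case True
    then show ?thesis using acts(4) by auto
  next
    case False
    then show ?thesis using steps[of n] by (simp add: step_def)
  qed
  then show ?case using step.IH by blast
qed simp

lemma in_verts: "a < k \<Longrightarrow> loc (c n) a \<in> pverts (topology N)"
proof (induction n)
  case 0
  then show ?case using init by (simp add: config_ok_def)
next
  case (Suc n)
  then show ?case using acts(1) idle(1) target_in_verts[OF net] by (cases "a \<in> S n") auto
qed

text \<open>Only its own actions change the location and the state of an agent, so at its first
  action from time \<open>n\<close> on both are as at time \<open>n\<close>.\<close>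

lemma next_action:
  assumes "a < k"
  shows "\<exists>m\<ge>n. a \<in> S m \<and> loc (c m) a = loc (c n) a \<and> state (c m) a = state (c n) a"
proof -
  define m where "m = (LEAST m. n \<le> m \<and> a \<in> S m)"
  have m: "n \<le> m" "a \<in> S m"
    using LeastI_ex[of "\<lambda>m. n \<le> m \<and> a \<in> S m"] fair[OF assms, of n] by (auto simp: m_def)
  have "i \<le> m \<longrightarrow> loc (c i) a = loc (c n) a \<and> state (c i) a = state (c n) a" if "n \<le> i" for i
    using that
  proof (induction rule: dec_induct)
    case (step i)
    show ?case
    proof
      assume "Suc i \<le> m"
      then have "a \<notin> S i" using not_less_Least[of i "\<lambda>m. n \<le> m \<and> a \<in> S m"] step.hyps by (auto simp: m_def)
      then show "loc (c (Suc i)) a = loc (c n) a \<and> state (c (Suc i)) a = state (c n) a"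
        using idle step.IH \<open>Suc i \<le> m\<close> by simp
    qed
  qed simp
  then show ?thesis using m by blast
qed

text \<open>Induction over the agent's own actions, with \<open>next_action\<close> bridging the
  idle time between them. At time \<open>m\<close> the agent has read \<open>i\<close> letters and
  acts at the node reached, which is when it reads and posts there.\<close>

lemma follows_word:
  assumes "a < k" "\<forall>x<length ps. universal_seq (state (c n) a + x) = ps ! x" "i \<le> length ps"
  shows "\<exists>m\<ge>n. a \<in> S m \<and> state (c m) a = state (c n) a + i \<and>
           loc (c m) a = follow N (loc (c n) a) (take i ps)"
  using assms(3)
proof (induction i)
  case 0
  then show ?case using next_action[OF assms(1), of n] by (auto simp: follow_def)
next
  case (Suc i)
  then obtain m where m: "m \<ge> n" "a \<in> S m" "state (c m) a = state (c n) a + i"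
    "loc (c m) a = follow N (loc (c n) a) (take i ps)" by auto
  obtain m' where m': "m' \<ge> Suc m" "a \<in> S m'" "loc (c m') a = loc (c (Suc m)) a"
    "state (c m') a = state (c (Suc m)) a" using next_action[OF assms(1)] by blast
  have "loc (c (Suc m)) a = follow N (loc (c n) a) (take (Suc i) ps)"
    using acts(1)[OF m(2)] m assms(2) Suc.prems
    by (simp add: take_Suc_conv_app_nth follow_def)
  then show ?case using m' m acts(2)[OF m(2)] by (intro exI[of _ m']) simp
qed

lemma reaches_state:
  assumes "a < k" "state (c n) a \<le> j"
  shows "\<exists>m\<ge>n. state (c m) a = j"
proof -
  \<comment> \<open>The word is read off the sequence itself; its length \<open>j\<close> covers the
    \<open>j - state (c n) a\<close> actions still missing.\<close>
  define ps where "ps = map (\<lambda>x. universal_seq (state (c n) a + x)) [0..<j]"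
  have "\<forall>x<length ps. universal_seq (state (c n) a + x) = ps ! x" by (simp add: ps_def)
  from follows_word[OF assms(1) this, of "j - state (c n) a"] show ?thesis
    using assms(2) by (auto simp: ps_def)
qed

text \<open>Where the agent stands when its counter reaches an occurrence of the covering word is
  unknown, but that word leads past \<open>v\<close> from every node.\<close>

lemma visits:
  assumes "a < k" "v \<in> pverts (topology N)"
  shows "\<exists>m\<ge>n. a \<in> S m \<and> loc (c m) a = v"
proof -
  obtain ps where
    ps: "\<forall>u\<in>pverts (topology N). \<exists>i\<le>length ps. follow N u (take i ps) = v"
    using covering_word[OF net assms(2)] by blast
  obtain j where j: "j \<ge> state (c n) a" "\<forall>x<length ps. universal_seq (j + x) = ps ! x"
    using universal_seq_contains by blast
  obtain m where m: "m \<ge> n" "state (c m) a = j" using reaches_state[OF assms(1) j(1)] by blast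
  obtain i where i: "i \<le> length ps" "follow N (loc (c m) a) (take i ps) = v"
    using ps in_verts[OF assms(1)] by blast
  from follows_word[OF assms(1) _ i(1), of m] j(2) m i(2) show ?thesis
    by (metis le_trans)
qed

lemma gossips:
  assumes "a < k"
  shows "\<exists>n. g ` {..<k} \<subseteq> knows g (c n) a"
proof -
  \<comment> \<open>Any node could be the common one; this one certainly belongs to the
    network.\<close>
  define v where "v = loc (c 0) a"
  have v: "v \<in> pverts (topology N)" using in_verts[OF assms] by (simp add: v_def)
  have "\<exists>n. g b \<in> posted (c n) v" if b: "b < k" for b
  proof -
    obtain m where "b \<in> S m" "loc (c m) b = v" using visits[OF b v] by blast
    then have "g b \<in> posted (c (Suc m)) v" using acts(4)[of b m] by (simp add: knows_def)
    then show ?thesis by blast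
  qed
  then obtain f where f: "\<And>b. b < k \<Longrightarrow> g b \<in> posted (c (f b)) v" by metis
  \<comment> \<open>By this time every agent has posted at \<open>v\<close>, and posted gossip is
    never erased.\<close>
  obtain m where m: "m \<ge> Max (f ` {..<k})" "a \<in> S m" "loc (c m) a = v"
    using visits[OF assms v] by blast
  have "g b \<in> posted (c m) v" if b: "b < k" for b
  proof -
    have "f b \<le> Max (f ` {..<k})" using b by (intro Max_ge) auto
    then show ?thesis using posted_mono[of "f b" m] f[OF b] m(1) by force
  qed
  then have "g ` {..<k} \<subseteq> knows g (c (Suc m)) a"
    using acts(3)[OF m(2)] m(3) by (auto simp: knows_def)
  then show ?thesis by blast
qed

end

lemma traversal_gossip_self_stabilizing: "self_stabilizing_gossip d traversal_gossip"
  unfolding self_stabilizing_gossip_def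
proof (intro allI impI)
  fix N k g c a
  assume "network N \<and> 1 \<le> k \<and> execution d traversal_gossip N k g c" "a < k"
  moreover from this obtain S where
    "traversal_run d N k g S c"
    by (auto simp: execution_def traversal_run_def)
  ultimately show "\<exists>n. g ` {..<k} \<subseteq> knows g (c n) a"
    using traversal_run.gossips by blast
qed

lemma quiescent_nonpos: "l \<le> 0 \<Longrightarrow> quiescent d l k A"
  by (auto simp: quiescent_def intro: exI[of _ "{}"])

section \<open>Agents in lockstep on a ring\<close>

definition ring_node :: "nat \<Rightarrow> int \<Rightarrow> nat" where
  "ring_node m x = nat (x mod (3 * int m))"

definition ring :: "nat \<Rightarrow> network" where
  "ring m =
     \<lparr> topology =
         \<lparr> pverts = range (ring_node m),
           parcs = range (\<lambda>x. (ring_node m x, ring_node m (x + 1))) \<union>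
                   range (\<lambda>x. (ring_node m (x + 1), ring_node m x)) \<rparr>,
       label = (\<lambda>u v. if v = ring_node m (int u + 1) then 0 else 1) \<rparr>"

text \<open>This is the displacement on the unrolled ring; exit labels other than 0 and 1 do not
  occur on the ring and leave the agent in place.\<close>

definition shift :: "nat option \<Rightarrow> int" where
  "shift e = (if e = Some 0 then 1 else if e = Some 1 then -1 else 0)"

lemma shift_cases: "shift e = 0 \<or> shift e = 1 \<or> shift e = - 1"
  by (simp add: shift_def)

context
  fixes m :: nat
  assumes m: "m \<ge> 1"
begin

lemma ring_node_eq_iff: "ring_node m x = ring_node m y \<longleftrightarrow> 3 * int m dvd x - y"
  using m by (simp add: ring_node_def eq_nat_nat_iff mod_eq_dvd_iff)

lemma not_dvd_small:
  assumes "\<bar>x\<bar> \<le> 2"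
  shows "3 * int m dvd x \<longleftrightarrow> x = 0"
  using zdvd_imp_le[of "3 * int m" "\<bar>x\<bar>"] m assms by auto

lemma ring_node_int: "ring_node m (int (ring_node m x) + y) = ring_node m (x + y)"
  using m by (simp add: ring_node_def mod_add_left_eq)

lemma ring_node_less: "ring_node m x < 3 * m"
  using m pos_mod_bound[of "3 * int m" x] by (auto simp: ring_node_def nat_less_iff)

lemma ring_nbrs: "nbrs (ring m) (ring_node m x) = {ring_node m (x + 1), ring_node m (x - 1)}"
proof (intro set_eqI iffI)
  fix v assume "v \<in> nbrs (ring m) (ring_node m x)"
  then obtain y where "ring_node m x = ring_node m y \<and> v = ring_node m (y + 1) \<or>
      ring_node m x = ring_node m (y + 1) \<and> v = ring_node m y"
    by (auto simp: nbrs_def ring_def)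
  then have "v = ring_node m (x + 1) \<or> v = ring_node m (x - 1)"
  proof (elim disjE conjE)
    assume "ring_node m x = ring_node m y" "v = ring_node m (y + 1)"
    then show ?thesis by (simp add: ring_node_eq_iff dvd_diff_commute)
  next
    assume v: "ring_node m x = ring_node m (y + 1)" "v = ring_node m y"
    from v(1) have "3 * int m dvd y + 1 - x"
      by (simp only: ring_node_eq_iff dvd_diff_commute[of _ x])
    moreover have "y + 1 - x = y - (x - 1)" by simp
    ultimately have "ring_node m y = ring_node m (x - 1)" by (simp only: ring_node_eq_iff)
    then show ?thesis using v(2) by simp
  qed
  then show "v \<in> {ring_node m (x + 1), ring_node m (x - 1)}" by simp
next
  fix v assume "v \<in> {ring_node m (x + 1), ring_node m (x - 1)}"
  moreover have "(ring_node m x, ring_node m (x - 1)) \<in>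
      range (\<lambda>x. (ring_node m (x + 1), ring_node m x))"
    by (rule range_eqI[of _ _ "x - 1"]) simp
  ultimately show "v \<in> nbrs (ring m) (ring_node m x)"
    by (auto simp: nbrs_def ring_def)
qed

lemma ring_label_succ: "label (ring m) (ring_node m x) (ring_node m (x + 1)) = 0"
  by (simp add: ring_def ring_node_int)

lemma ring_label_pred: "label (ring m) (ring_node m x) (ring_node m (x - 1)) = 1"
  \<comment> \<open>The label is 1 because predecessor and successor, which differ by 2, are
    distinct modulo \<open>3 m\<close>.\<close>
  using not_dvd_small[of "-2"] by (simp add: ring_def ring_node_int ring_node_eq_iff)

lemma ring_network: "network (ring m)"
proof -
  let ?G = "topology (ring m)"
  have verts: "pverts ?G \<subseteq> {..<3 * m}" using ring_node_less by (auto simp: ring_def)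
  have sub: "parcs ?G \<subseteq> pverts ?G \<times> pverts ?G" by (auto simp: ring_def)
  have fin: "finite (pverts ?G)" by (rule finite_subset[OF verts]) simp
  have "finite (parcs ?G)" by (rule finite_subset[OF sub]) (simp add: fin)
  moreover have "sym (parcs ?G)" by (auto simp: ring_def sym_def)
  moreover have "fst e \<noteq> snd e" if "e \<in> parcs ?G" for e
    using that not_dvd_small[of 1] not_dvd_small[of "-1"] by (auto simp: ring_def ring_node_eq_iff)
  ultimately interpret pair_graph ?G
    using sub fin by unfold_locales (auto simp: symmetric_def)
  have reach: "(ring_node m 0, ring_node m (int n)) \<in> rtrancl_on (pverts ?G) (parcs ?G)" for n
  proof (induction n)
    case 0
    show ?case by (auto simp: ring_def)
  next
    case (Suc n)
    moreover have "(ring_node m (int n), ring_node m (int (Suc n))) \<in> parcs ?G"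
      by (auto simp: ring_def add.commute)
    ultimately show ?case by (rule rtrancl_on_into_rtrancl_on) (auto simp: ring_def)
  qed
  \<comment> \<open>The number \<open>u\<close> of a node is also one of its positions, so
    \<open>u\<close> forward steps from position 0 lead there.\<close>
  have from0: "(ring_node m 0, u) \<in> rtrancl_on (pverts ?G) (parcs ?G)" if u: "u \<in> pverts ?G" for u
  proof -
    obtain x where "u = ring_node m x" using u by (auto simp: ring_def)
    then have "ring_node m (int u) = u" using ring_node_int[of x 0] by simp
    then show ?thesis using reach[of u] by simp
  qed
  have "(u, v) \<in> rtrancl_on (pverts ?G) (parcs ?G)" if "u \<in> pverts ?G" "v \<in> pverts ?G" for u v
    using rtrancl_on_trans[OF symD[OF rtrancl_on_sym[OF \<open>sym (parcs ?G)\<close>] from0] from0] that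
    by blast
  then have "strongly_connected (with_proj ?G)"
    by (auto simp: strongly_connected_def reachable_def ring_def)
  then have "connected (with_proj ?G)"
    unfolding connected_def strongly_connected_def
    using reachable_mk_symmetricI by simp
  moreover have "inj_on (label (ring m) u) (nbrs (ring m) u)" if "u \<in> pverts ?G" for u
  proof -
    obtain x where "u = ring_node m x" using \<open>u \<in> pverts ?G\<close> by (auto simp: ring_def)
    then show ?thesis
      using ring_nbrs[of x] ring_label_succ[of x] ring_label_pred[of x] by (auto simp: inj_on_def)
  qed
  ultimately show ?thesis using pair_graph_axioms by (simp add: network_def)
qed

lemma ring_labels_at: "labels_at (ring m) (ring_node m x) = {0, 1}"
  using ring_nbrs[of x] ring_label_succ[of x] ring_label_pred[of x] by (simp add: labels_at_def)

lemma ring_target: "target (ring m) (ring_node m x) e = ring_node m (x + shift e)"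
proof -
  have "(ring_node m x, ring_node m (x + 1)) \<in> parcs (topology (ring m))"
    "(ring_node m x, ring_node m (x - 1)) \<in> parcs (topology (ring m))"
    using ring_nbrs[of x] by (auto simp: nbrs_def)
  from this[THEN target_label[OF ring_network]]
  have "target (ring m) (ring_node m x) (Some 0) = ring_node m (x + 1)"
    "target (ring m) (ring_node m x) (Some 1) = ring_node m (x - 1)"
    using ring_label_succ[of x] ring_label_pred[of x] by simp_all
  moreover have "target (ring m) (ring_node m x) e = ring_node m x" if "e \<noteq> Some 0" "e \<noteq> Some 1"
    using that by (auto simp: target_def ring_labels_at split: option.splits)
  ultimately show ?thesis by (auto simp: shift_def)
qed

end

text \<open>
  A probe consists of a position on the unrolled ring, a control state, an entry label and the
  whiteboards of a triangle. On a ring of \<open>3 m\<close> nodes it describes \<open>m\<close> agents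
  at mutual distances divisible by \<open>3\<close>, acting in lockstep; their behaviour does not
  depend on \<open>m\<close>. Distance \<open>3\<close> keeps the agents from ever meeting, and from
  crossing a link in opposite directions.
\<close>

type_synonym ('q, 'w) probe = "int \<times> 'q \<times> nat option \<times> (int \<Rightarrow> 'w)"

fun probe_action :: "('q, 'w) algorithm \<Rightarrow> ('q, 'w) probe \<Rightarrow> ('q, 'w) action" where
  "probe_action A (p, q, e, w) =
     A \<lparr> own_state = q, other_states = {#}, link_labels = {0, 1}, entry_label = e,
         board = w (p mod 3) \<rparr>"

text \<open>The entry label belongs to the node of arrival: a forward move arrives through the link
  labelled 1 there, a backward move through the one labelled 0.\<close>

definition probe_step :: "('q, 'w) algorithm \<Rightarrow> ('q, 'w) probe \<Rightarrow> ('q, 'w) probe" where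
  "probe_step A P =
     (let act = probe_action A P; (p, q, e, w) = P; s = shift (exit_label act) in
       (p + s, new_state act,
        if s = 0 then e else if s = 1 then Some 1 else Some 0,
        w(p mod 3 := new_board act)))"

text \<open>Memories and posted gossip are left free, since no view shows them. The condition on
  \<open>e\<close> makes the entry label legal at every node of the ring.\<close>

fun in_lockstep :: "nat \<Rightarrow> ('q, 'w) probe \<Rightarrow> ('q, 'w) config \<Rightarrow> bool" where
  "in_lockstep m (p, q, e, w) c \<longleftrightarrow>
     (\<forall>a<m. loc c a = ring_node m (p + 3 * int a) \<and> state c a = q \<and> entry c a = e) \<and>
     (\<forall>x. content c (ring_node m x) = w (x mod 3)) \<and>
     e \<in> {None, Some 0, Some 1}"

text \<open>
  A legal step only while the agents are at distinct nodes; the choice made by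
  \<open>inv_into\<close> is then unique.
\<close>

definition all_act ::
  "('q, 'w) algorithm \<Rightarrow> network \<Rightarrow> nat \<Rightarrow> (nat \<Rightarrow> nat) \<Rightarrow> ('q, 'w) config \<Rightarrow> ('q, 'w) config"
  where
  "all_act A N k g c =
     (let act = (\<lambda>a. A (view_of N k c a)); occupied = loc c ` {..<k};
          agent = inv_into {..<k} (loc c) in
      \<lparr> loc = (\<lambda>a. if a < k then destination A N k c a else loc c a),
        state = (\<lambda>a. if a < k then new_state (act a) else state c a),
        entry = (\<lambda>a. if a < k \<and> destination A N k c a \<noteq> loc c a
                     then Some (label N (destination A N k c a) (loc c a)) else entry c a),
        memory = (\<lambda>a. if a < k
                      then memory c a \<union> (\<Union>s\<in>learn_from (act a). gossip_of k g c a s)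
                      else memory c a),
        content = (\<lambda>u. if u \<in> occupied then new_board (act (agent u)) else content c u),
        posted = (\<lambda>u. if u \<in> occupied
                      then (\<Union>s\<in>post_from (act (agent u)). gossip_of k g c (agent u) s)
                      else posted c u) \<rparr>)"

lemma step_all_act:
  assumes "inj_on (loc c) {..<k}"
    and "\<And>a b. a < k \<Longrightarrow> b < k \<Longrightarrow> a \<noteq> b \<Longrightarrow>
           \<not> (destination A N k c a = loc c b \<and> destination A N k c b = loc c a)"
  shows "step d A N k g {..<k} c (all_act A N k g c)"
  unfolding step_def
  using assms by (auto simp: all_act_def Let_def)

context
  fixes m :: nat
  assumes m: "m \<ge> 1"
begin

text \<open>The positions of agents \<open>a\<close> and \<open>b\<close> differ by
  \<open>3 * (a - b)\<close>, a multiple of \<open>3 m\<close> only if \<open>a = b\<close>, as both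
  are below \<open>m\<close>.\<close>

lemma lockstep_inj:
  assumes "in_lockstep m P c"
  shows "inj_on (loc c) {..<m}"
proof (rule inj_onI)
  obtain p q e w where P: "P = (p, q, e, w)" by (cases P)
  fix a b assume ab: "a \<in> {..<m}" "b \<in> {..<m}" "loc c a = loc c b"
  then have "3 * int m dvd 3 * (int a - int b)"
    using assms by (simp add: P ring_node_eq_iff[OF m] right_diff_distrib)
  then have "int m dvd int a - int b" unfolding dvd_mult_cancel_left by simp
  then show "a = b"
    using ab(1,2) zdvd_imp_le[of "int m" "\<bar>int a - int b\<bar>"] by (cases "a = b") auto
qed

text \<open>Each agent is alone, and multiples of 3 do not affect which board of the triangle it
  reads. The action depends neither on the agent nor on \<open>m\<close>, so a probe can be carried
  from one ring to another.\<close>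

lemma lockstep_action:
  assumes "in_lockstep m (p, q, e, w) c" "a < m"
  shows "A (view_of (ring m) m c a) = probe_action A (p, q, e, w)"
proof -
  have "others_here m c a = {}"
    using inj_onD[OF lockstep_inj[OF assms(1)]] assms(2) by (auto simp: others_here_def)
  moreover have "content c (loc c a) = w ((p + 3 * int a) mod 3)" using assms by simp
  ultimately show ?thesis
    using assms by (simp add: view_of_def ring_labels_at[OF m])
qed

lemma lockstep_destination:
  assumes "in_lockstep m (p, q, e, w) c" "a < m"
  shows "destination A (ring m) m c a =
           ring_node m (p + shift (exit_label (probe_action A (p, q, e, w))) + 3 * int a)"
  using assms(1) assms(2)
  by (simp only: destination_def lockstep_action[OF assms, of A])
    (simp add: ring_target[OF m] algebra_simps)

text \<open>All agents move by the same amount, at most one step. Ending on another agent's node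
  would make this amount divisible by 3, hence 0, and then two agents would share a node
  already.\<close>

lemma lockstep_step:
  assumes "in_lockstep m P c"
  shows "step d A (ring m) m g {..<m} c (all_act A (ring m) m g c)"
proof (rule step_all_act[OF lockstep_inj[OF assms]], rule notI)
  obtain p q e w where P: "P = (p, q, e, w)" by (cases P)
  let ?s = "shift (exit_label (probe_action A P))"
  fix a b assume ab: "a < m" "b < m" "a \<noteq> b"
    "destination A (ring m) m c a = loc c b \<and> destination A (ring m) m c b = loc c a"
  have dest: "destination A (ring m) m c x = ring_node m (p + ?s + 3 * int x)" if "x < m" for x
    using lockstep_destination[of p q e w c x A] assms that by (simp add: P)
  have "ring_node m (p + ?s + 3 * int a) = ring_node m (p + 3 * int b)"
    using ab dest assms by (simp add: P)
  then have dvd: "3 * int m dvd ?s + 3 * (int a - int b)"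
    by (simp add: ring_node_eq_iff[OF m] algebra_simps)
  then have "3 dvd ?s + 3 * (int a - int b)" by (rule dvd_mult_left)
  then have "3 dvd ?s" by presburger
  then have "?s = 0" using shift_cases[of "exit_label (probe_action A P)"] by auto
  have "loc c b = ring_node m (p + ?s + 3 * int a)" using ab(4) dest[OF ab(1)] by simp
  also have "\<dots> = loc c a" using \<open>?s = 0\<close> ab(1) assms by (simp add: P)
  finally have "loc c a = loc c b" ..
  then show False using inj_onD[OF lockstep_inj[OF assms]] ab by simp
qed

text \<open>The occupied nodes form one residue class modulo 3, so simultaneous writing by all
  agents changes exactly one board of the triangle.\<close>

lemma occupied_iff:
  assumes "in_lockstep m (p, q, e, w) c"
  shows "ring_node m x \<in> loc c ` {..<m} \<longleftrightarrow> x mod 3 = p mod 3"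
proof
  assume "ring_node m x \<in> loc c ` {..<m}"
  then obtain a where "ring_node m x = ring_node m (p + 3 * int a)" using assms by auto
  then have "3 * int m dvd x - (p + 3 * int a)" by (simp add: ring_node_eq_iff[OF m])
  then have "3 dvd x - (p + 3 * int a)" by (rule dvd_mult_left)
  then show "x mod 3 = p mod 3" by presburger
next
  assume "x mod 3 = p mod 3"
  then have "3 dvd x - p" by (simp add: mod_eq_dvd_iff)
  then obtain j where j: "x - p = 3 * j" ..
  \<comment> \<open>Advancing by \<open>m\<close> agents is a full turn of the ring, so
    \<open>j\<close> modulo \<open>m\<close> is the agent at \<open>x\<close>.\<close>
  define a where "a = nat (j mod int m)"
  have a: "a < m" "int a = j mod int m" using m by (auto simp: a_def nat_less_iff)
  have "int m dvd j - int a" by (simp add: a mod_eq_dvd_iff[symmetric])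
  then have "3 * int m dvd 3 * (j - int a)" by (rule mult_dvd_mono[OF dvd_refl])
  also have "3 * (j - int a) = x - (p + 3 * int a)" using j by simp
  finally have "ring_node m x = loc c a"
    using assms a(1) by (simp add: ring_node_eq_iff[OF m])
  then show "ring_node m x \<in> loc c ` {..<m}" using a(1) by blast
qed

lemma lockstep_preserved:
  assumes "in_lockstep m P c"
  shows "in_lockstep m (probe_step A P) (all_act A (ring m) m g c)"
proof -
  obtain p q e w where P: "P = (p, q, e, w)" by (cases P)
  note L = assms[unfolded P]
  define act where "act = probe_action A (p, q, e, w)"
  define s where "s = shift (exit_label act)"
  let ?c = "all_act A (ring m) m g c"
  have view: "A (view_of (ring m) m c a) = act" if "a < m" for a
    unfolding act_def by (rule lockstep_action[OF L that])
  have dest: "destination A (ring m) m c a = ring_node m (p + s + 3 * int a)" if "a < m" for a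
    unfolding s_def act_def by (rule lockstep_destination[OF L that])
  have loc: "loc c a = ring_node m (p + 3 * int a)" if "a < m" for a using L that by simp
  have s: "s = 0 \<or> s = 1 \<or> s = - 1" unfolding s_def by (rule shift_cases)
  have ent: "entry ?c a = (if s = 0 then e else if s = 1 then Some 1 else Some 0)"
    if a: "a < m" for a
  proof -
    have "destination A (ring m) m c a = loc c a \<longleftrightarrow> s = 0"
      using dest[OF a] loc[OF a] s not_dvd_small[OF m, of s] by (auto simp: ring_node_eq_iff[OF m])
    moreover have "label (ring m) (ring_node m (p + 1 + 3 * int a)) (loc c a) = 1"
      using ring_label_pred[OF m, of "p + 1 + 3 * int a"] loc[OF a] by (simp add: algebra_simps)
    moreover have "label (ring m) (ring_node m (p + - 1 + 3 * int a)) (loc c a) = 0"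
      using ring_label_succ[OF m, of "p - 1 + 3 * int a"] loc[OF a] by (simp add: algebra_simps)
    moreover have "entry ?c a =
        (if destination A (ring m) m c a = loc c a then e
         else Some (label (ring m) (destination A (ring m) m c a) (loc c a)))"
      using a L by (simp add: all_act_def Let_def)
    ultimately show ?thesis
      using s by (elim disjE) (simp_all add: dest[OF a])
  qed
  have cont: "content ?c (ring_node m x) = (w(p mod 3 := new_board act)) (x mod 3)" for x
  proof (cases "ring_node m x \<in> loc c ` {..<m}")
    case True
    then have "inv_into {..<m} (loc c) (ring_node m x) < m"
      using inv_into_into[OF True] by simp
    then have "content ?c (ring_node m x) = new_board act"
      using True view by (simp add: all_act_def Let_def)
    then show ?thesis using True occupied_iff[OF L] by simp
  next
    case False
    then show ?thesis using occupied_iff[OF L, of x] L by (simp add: all_act_def Let_def)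
  qed
  have "probe_step A P =
      (p + s, new_state act, if s = 0 then e else if s = 1 then Some 1 else Some 0,
       w(p mod 3 := new_board act))"
    by (simp add: probe_step_def P act_def s_def Let_def)
  moreover have "loc ?c a = ring_node m (p + s + 3 * int a)" "state ?c a = new_state act"
    if "a < m" for a
    using that dest view by (auto simp: all_act_def Let_def)
  ultimately show ?thesis using ent cont L by simp
qed

lemma lockstep_run:
  assumes "in_lockstep m P c"
  shows "in_lockstep m ((probe_step A ^^ t) P) ((all_act A (ring m) m g ^^ t) c)"
  by (induction t) (simp_all add: assms lockstep_preserved)

lemma lockstep_execution:
  assumes "in_lockstep m P c"
  shows "execution d A (ring m) m g (\<lambda>t. (all_act A (ring m) m g ^^ t) c)"
  unfolding execution_def
proof (intro conjI exI[of _ "\<lambda>_. {..<m}"] allI impI)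
  obtain p q e w where P: "P = (p, q, e, w)" by (cases P)
  show "config_ok (ring m) m ((all_act A (ring m) m g ^^ 0) c)"
    using assms by (auto simp: P config_ok_def ring_labels_at[OF m]) (auto simp: ring_def)
  show "step d A (ring m) m g {..<m} ((all_act A (ring m) m g ^^ n) c)
          ((all_act A (ring m) m g ^^ Suc n) c)" for n
    using lockstep_step[OF lockstep_run[OF assms]] by simp
qed auto

end

text \<open>A probe with a legal entry label, possibly reached in another run, can serve as initial
  configuration on a ring for any number of agents, with all gathered gossip erased.\<close>

lemma lockstep_exists:
  assumes "m \<ge> 1" "snd (snd P) = (e, w)" "e \<in> {None, Some 0, Some 1}"
  shows "\<exists>c :: ('q, 'w) config. in_lockstep m (P :: ('q, 'w) probe) c \<and>
           (\<forall>a. memory c a = {}) \<and> (\<forall>u. posted c u = {})"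
proof -
  obtain p q where P: "P = (p, q, e, w)" using assms(2) by (cases P) auto
  have "int (ring_node m x) mod 3 = x mod 3" for x
    using assms(1) by (simp add: ring_node_def mod_mod_cancel)
  then have "in_lockstep m P
      \<lparr> loc = (\<lambda>a. ring_node m (p + 3 * int a)), state = (\<lambda>_. q), entry = (\<lambda>_. e),
        memory = (\<lambda>_. {}), content = (\<lambda>u. w (int u mod 3)), posted = (\<lambda>_. {}) \<rparr>"
    using assms(3) by (simp add: P)
  then show ?thesis by fastforce
qed

section \<open>Agents that stand still never exchange gossip\<close>

text \<open>An agent alone at its node can draw only on its own knowledge and its board, and nobody
  else writes on that board.\<close>

lemma isolated_step:
  assumes "step d A N k g S c c'" "inj_on (loc c) {..<k}"
    and "\<forall>a<k. memory c a \<subseteq> {g a} \<and> posted c (loc c a) \<subseteq> {g a}"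
    and "\<forall>a<k. loc c' a = loc c a"
  shows "\<forall>a<k. memory c' a \<subseteq> {g a} \<and> posted c' (loc c' a) \<subseteq> {g a}"
proof (intro allI impI)
  fix a assume a: "a < k"
  have S: "S \<subseteq> {..<k}" using assms(1) by (simp add: step_def)
  show "memory c' a \<subseteq> {g a} \<and> posted c' (loc c' a) \<subseteq> {g a}"
  proof (cases "a \<in> S")
    case True
    have "others_here k c a = {}"
      using inj_onD[OF assms(2)] a by (auto simp: others_here_def)
    then have "gossip_of k g c a s \<subseteq> {g a}" for s
      using assms(3) a by (cases s) (auto simp: knows_def)
    then have src: "(\<Union>s\<in>X. gossip_of k g c a s) \<subseteq> {g a}" for X by blast
    have "memory c' a = memory c a \<union>
        (\<Union>s\<in>learn_from (A (view_of N k c a)). gossip_of k g c a s)"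
      "posted c' (loc c a) = (\<Union>s\<in>post_from (A (view_of N k c a)). gossip_of k g c a s)"
      using assms(1) True by (simp_all add: step_def Let_def)
    then show ?thesis using src assms(3,4) a by simp
  next
    case False
    then have "loc c a \<notin> loc c ` S" using inj_onD[OF assms(2)] a S by blast
    then have "posted c' (loc c a) = posted c (loc c a)" "memory c' a = memory c a"
      using assms(1) False by (simp_all add: step_def)
    then show ?thesis using assms(3,4) a by simp
  qed
qed

lemma still_agent_not_self_stabilizing:
  fixes A :: "('q, 'w) algorithm"
  assumes P: "snd (snd P) = (e, w)" "e \<in> {None, Some 0, Some 1}"
    and still: "\<And>t. fst ((probe_step A ^^ t) P) = fst P"
  shows "\<not> self_stabilizing_gossip d A"
proof
  assume ss: "self_stabilizing_gossip d A"
  obtain c0 :: "('q, 'w) config" where c0: "in_lockstep 2 P c0"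
    "\<forall>a. memory c0 a = {}" "\<forall>u. posted c0 u = {}"
    using lockstep_exists[OF _ P, of 2] by auto
  \<comment> \<open>With \<open>id\<close> as gossip the two agents hold different information, so
    agent 0 has something to learn.\<close>
  define c where "c = (\<lambda>t. (all_act A (ring 2) 2 id ^^ t) c0)"
  have run: "in_lockstep 2 ((probe_step A ^^ t) P) (c t)" for t
    unfolding c_def by (rule lockstep_run) (use c0 in auto)
  have loc: "loc (c t) a = ring_node 2 (fst P + 3 * int a)" if "a < 2" for t a
    using run[of t] still[of t] that by (cases "(probe_step A ^^ t) P") auto
  have inj: "inj_on (loc (c t)) {..<2}" for t using lockstep_inj[OF _ run] by simp
  have "step d A (ring 2) 2 id {..<2} (c t) (c (Suc t))" for t
    using lockstep_step[OF _ run] by (simp add: c_def)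
  note iso = isolated_step[OF this inj]
  have isolated: "\<forall>a<2. memory (c t) a \<subseteq> {id a} \<and> posted (c t) (loc (c t) a) \<subseteq> {id a}" for t
  proof (induction t)
    case 0
    then show ?case using c0 by (simp add: c_def)
  next
    case (Suc t)
    then show ?case using loc by (intro iso) simp_all
  qed
  have "execution d A (ring 2) 2 id c"
    using lockstep_execution[OF _ c0(1)] by (simp add: c_def)
  then obtain n where "id ` {..<2} \<subseteq> knows id (c n) 0"
    using ss[unfolded self_stabilizing_gossip_def, rule_format, of "ring 2" 2 id c 0]
      ring_network[of 2] by auto
  moreover have "(1::nat) \<in> id ` {..<2}" by simp
  ultimately have "(1::nat) \<in> knows id (c n) 0" by blast
  then show False using isolated[of n] by (force simp: knows_def)
qed

lemma quiescent_not_self_stabilizing: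
  fixes A :: "('q, 'w) algorithm"
  assumes k: "k \<ge> 1" and l: "l \<ge> 1" and q: "quiescent d l k A"
  shows "\<not> self_stabilizing_gossip d A"
proof -
  \<comment> \<open>The initial probe is arbitrary apart from its legal entry label.\<close>
  define P0 :: "('q, 'w) probe" where "P0 = (0, undefined, None, \<lambda>_. undefined)"
  define P where "P t = (probe_step A ^^ t) P0" for t
  obtain c0 :: "('q, 'w) config" where c0: "in_lockstep k P0 c0"
    using lockstep_exists[OF k, of P0] by (auto simp: P0_def)
  define c where "c = (\<lambda>t. (all_act A (ring k) k id ^^ t) c0)"
  have run: "in_lockstep k (P t) (c t)" for t
    unfolding c_def P_def by (rule lockstep_run[OF k c0])
  have "execution d A (ring k) k id c"
    using lockstep_execution[OF k c0] by (simp add: c_def)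
  then obtain n Q where Q: "Q \<subseteq> {..<k}" "l \<le> int (card Q)"
    "\<forall>a\<in>Q. \<forall>t\<ge>n. loc (c t) a = loc (c n) a"
    using q[unfolded quiescent_def, rule_format, of "ring k" id c] ring_network[OF k] by blast
  have "Q \<noteq> {}" using Q(2) l by auto
  then obtain a where a: "a < k" "\<forall>t\<ge>n. loc (c t) a = loc (c n) a" using Q by blast
  have loc: "loc (c t) a = ring_node k (fst (P t) + 3 * int a)" for t
    using run[of t] a(1) by (cases "P t") auto
  \<comment> \<open>Stillness is lifted from the ring to its unrolling: a displacement of absolute
    value at most 2 that is divisible by \<open>3 k\<close> is 0.\<close>
  have still: "fst (P (n + t)) = fst (P n)" for t
  proof (induction t)
    case (Suc t)
    have "P (n + Suc t) = probe_step A (P (n + t))" by (simp add: P_def)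
    then obtain s where s: "fst (P (n + Suc t)) = fst (P (n + t)) + s" "\<bar>s\<bar> \<le> 2"
      using shift_cases[of "exit_label (probe_action A (P (n + t)))"]
      by (cases "P (n + t)") (force simp: probe_step_def Let_def)
    have "loc (c (n + Suc t)) a = loc (c (n + t)) a"
      using a(2)[rule_format, of "n + Suc t"] a(2)[rule_format, of "n + t"] by simp
    then have "3 * int k dvd s" using s(1) by (simp add: loc ring_node_eq_iff[OF k])
    then show ?case using s Suc.IH not_dvd_small[OF k s(2)] by simp
  qed simp
  \<comment> \<open>From time \<open>n\<close> on the common probe stands still, so
    \<open>P n\<close> can be restarted with two agents; \<open>run\<close> shows that its entry
    label is legal.\<close>
  obtain p q e w where Pn: "P n = (p, q, e, w)" by (cases "P n")
  have "(probe_step A ^^ t) (P n) = P (n + t)" for t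
    by (simp add: P_def funpow_add add.commute[of n t])
  then have "fst ((probe_step A ^^ t) (P n)) = fst (P n)" for t using still by simp
  then show ?thesis
    using still_agent_not_self_stabilizing[of "P n" e w A d] run[of n] Pn by auto
qed

theorem theorem9:
  fixes d :: link_mode and k :: nat
  assumes "k \<ge> 1"
  shows "quiescence_number d k = 0 \<and>
    (\<exists>A :: (nat, nat) algorithm. self_stabilizing_gossip d A \<and> quiescent d 0 k A) \<and>
    (\<forall>l\<ge>1. \<not> (\<exists>A :: ('q, 'w) algorithm. self_stabilizing_gossip d A \<and> quiescent d l k A))"
proof -
  have zero: "quiescent_solution_exists d k 0"
    unfolding quiescent_solution_exists_def
    using traversal_gossip_self_stabilizing quiescent_nonpos by blast
  have "l \<le> 0" if "quiescent_solution_exists d k l" for l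
    using that quiescent_not_self_stabilizing[OF assms, of l d]
    by (force simp: quiescent_solution_exists_def)
  then have "quiescence_number d k = 0"
    using zero by (simp add: quiescence_number_def Greatest_equality)
  \<comment> \<open>The impossibility holds for arbitrary types of control states and boards, as the
    last conjunct demands.\<close>
  then show ?thesis
    using zero quiescent_not_self_stabilizing[OF assms]
    unfolding quiescent_solution_exists_def by blast
qed

end
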